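(* (a) There is a class $\mathcal{G}$ of convex bipartite grid-intersection graphs that are comparability graphs of $3$-dimensional posets such that $\mathcal{G}$ has unbounded proper odd chromatic number, i.e. $\sup_{G\in\mathcal{G}}\chi_{\mathrm{o}}(G)=\infty$. (b) There is a class $\mathcal{H}$ of bipartite circle graphs of bounded proper odd chromatic number and unbounded proper conflict-free chromatic number, i.e. $\sup_{H\in\mathcal{H}}\chi_{\mathrm{o}}(H)<\infty$ and $\sup_{H\in\mathcal{H}}\chi_{\mathrm{pcf}}(H)=\infty$.
   Context: Graphs are finite and simple. A bipartite graph is convex bipartite if it has a bipartition $(A,B)$ such that for one of the sides, say $A$, there is a linear order of $A$ such that for every $w\in B$ the vertices of $N(w)$ appear consecutively. A grid-intersection graph is a bipartite graph that is the intersection graph of a family of horizontal and vertical segments in the plane in which no two parallel segments intersect. The comparability graph of a poset has the elements as vertices and joins distinct comparable elements. A $3$-dimensional poset is one of (Dushnik–Miller) dimension at most $3$, i.e. its order is an intersection of three linear orders. A circle graph is an intersection graph of chords of a circle. A proper odd (resp. proper conflict-free) coloring is a proper vertex coloring in which for every non-isolated vertex some color appears an odd number of times (resp. exactly once) in its open neighborhood; $\chi_{\mathrm{o}}$ (resp. $\chi_{\mathrm{pcf}}$) is the least number of colors in such a coloring. *)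

theory Defs
  imports
    "HOL-Analysis.Analysis"
    "HOL-Library.Extended_Nat"
    "Graph_Theory.Pair_Digraph"
begin

text \<open>
  A finite simple graph is a \<^verbatim>\<open>pair_graph\<close>: a finite loop-free symmetric digraph without parallel
  arcs, where an edge \<open>uv\<close> is represented by the two arcs \<open>(u,v)\<close> and \<open>(v,u)\<close> in \<open>parcs G\<close>.
\<close>

definition nbhd :: "'a pair_pre_digraph \<Rightarrow> 'a \<Rightarrow> 'a set" where
  "nbhd G v = {u. (v, u) \<in> parcs G}"

definition bipartition :: "'a pair_pre_digraph \<Rightarrow> 'a set \<Rightarrow> 'a set \<Rightarrow> bool" where
  "bipartition G A B \<longleftrightarrow>
     A \<union> B = pverts G \<and> A \<inter> B = {} \<and> parcs G \<subseteq> A \<times> B \<union> B \<times> A"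

definition bipartite :: "'a pair_pre_digraph \<Rightarrow> bool" where
  "bipartite G \<longleftrightarrow> (\<exists>A B. bipartition G A B)"

text \<open>
  A set is consecutive in an order if it contains everything between any two of its members.
  As \<open>bipartition\<close> is symmetric in its two sides, it is enough to let \<open>A\<close> be the ordered one.
\<close>

definition consecutive :: "'a rel \<Rightarrow> 'a set \<Rightarrow> bool" where
  "consecutive r S \<longleftrightarrow> (\<forall>x\<in>S. \<forall>z\<in>S. \<forall>y. (x, y) \<in> r \<and> (y, z) \<in> r \<longrightarrow> y \<in> S)"

definition convex_bipartite :: "'a pair_pre_digraph \<Rightarrow> bool" where
  "convex_bipartite G \<longleftrightarrow>
     (\<exists>A B. bipartition G A B \<and>
        (\<exists>r. linear_order_on A r \<and> (\<forall>w\<in>B. consecutive r (nbhd G w))))"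

definition intersection_model :: "'a pair_pre_digraph \<Rightarrow> ('a \<Rightarrow> 'b set) \<Rightarrow> bool" where
  "intersection_model G S \<longleftrightarrow>
     (\<forall>u\<in>pverts G. \<forall>v\<in>pverts G. u \<noteq> v \<longrightarrow> ((u, v) \<in> parcs G \<longleftrightarrow> S u \<inter> S v \<noteq> {}))"

text \<open>Segments are nondegenerate, so that no segment is both horizontal and vertical.\<close>

definition horizontal_segment :: "(real \<times> real) set \<Rightarrow> bool" where
  "horizontal_segment S \<longleftrightarrow> (\<exists>a b c. a < b \<and> S = closed_segment (a, c) (b, c))"

definition vertical_segment :: "(real \<times> real) set \<Rightarrow> bool" where
  "vertical_segment S \<longleftrightarrow> (\<exists>a b c. a < b \<and> S = closed_segment (c, a) (c, b))"

definition grid_intersection_graph :: "'a pair_pre_digraph \<Rightarrow> bool" where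
  "grid_intersection_graph G \<longleftrightarrow> bipartite G \<and>
     (\<exists>S. intersection_model G S \<and>
        (\<forall>v\<in>pverts G. horizontal_segment (S v) \<or> vertical_segment (S v)) \<and>
        (\<forall>u\<in>pverts G. \<forall>v\<in>pverts G. u \<noteq> v \<and>
           (horizontal_segment (S u) \<and> horizontal_segment (S v) \<or>
            vertical_segment (S u) \<and> vertical_segment (S v)) \<longrightarrow> S u \<inter> S v = {}))"

definition comparability_graph_of :: "'a pair_pre_digraph \<Rightarrow> 'a rel \<Rightarrow> bool" where
  "comparability_graph_of G r \<longleftrightarrow> partial_order_on (pverts G) r \<and>
     (\<forall>u v. (u, v) \<in> parcs G \<longleftrightarrow> u \<noteq> v \<and> ((u, v) \<in> r \<or> (v, u) \<in> r))"

text \<open>The three linear orders need not be distinct, hence dimension at most 3.\<close>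

definition dim_at_most_3 :: "'a set \<Rightarrow> 'a rel \<Rightarrow> bool" where
  "dim_at_most_3 P r \<longleftrightarrow>
     (\<exists>L1 L2 L3. linear_order_on P L1 \<and> linear_order_on P L2 \<and> linear_order_on P L3 \<and>
        r = L1 \<inter> L2 \<inter> L3)"

definition comparability_graph_3dim :: "'a pair_pre_digraph \<Rightarrow> bool" where
  "comparability_graph_3dim G \<longleftrightarrow>
     (\<exists>r. comparability_graph_of G r \<and> dim_at_most_3 (pverts G) r)"

definition chord :: "(real \<times> real) \<Rightarrow> real \<Rightarrow> (real \<times> real) set \<Rightarrow> bool" where
  "chord c \<rho> S \<longleftrightarrow> (\<exists>p\<in>sphere c \<rho>. \<exists>q\<in>sphere c \<rho>. p \<noteq> q \<and> S = closed_segment p q)"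

definition circle_graph :: "'a pair_pre_digraph \<Rightarrow> bool" where
  "circle_graph G \<longleftrightarrow>
     (\<exists>c \<rho> S. \<rho> > 0 \<and> (\<forall>v\<in>pverts G. chord c \<rho> (S v)) \<and> intersection_model G S)"

definition proper_coloring :: "'a pair_pre_digraph \<Rightarrow> ('a \<Rightarrow> nat) \<Rightarrow> bool" where
  "proper_coloring G f \<longleftrightarrow> (\<forall>(u, v)\<in>parcs G. f u \<noteq> f v)"

definition proper_odd_coloring :: "'a pair_pre_digraph \<Rightarrow> ('a \<Rightarrow> nat) \<Rightarrow> bool" where
  "proper_odd_coloring G f \<longleftrightarrow> proper_coloring G f \<and>
     (\<forall>v\<in>pverts G. nbhd G v \<noteq> {} \<longrightarrow> (\<exists>c. odd (card {u \<in> nbhd G v. f u = c})))"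

definition proper_cf_coloring :: "'a pair_pre_digraph \<Rightarrow> ('a \<Rightarrow> nat) \<Rightarrow> bool" where
  "proper_cf_coloring G f \<longleftrightarrow> proper_coloring G f \<and>
     (\<forall>v\<in>pverts G. nbhd G v \<noteq> {} \<longrightarrow> (\<exists>c. card {u \<in> nbhd G v. f u = c} = 1))"

definition chi_o :: "'a pair_pre_digraph \<Rightarrow> nat" where
  "chi_o G = (LEAST k. \<exists>f. proper_odd_coloring G f \<and> card (f ` pverts G) = k)"

definition chi_pcf :: "'a pair_pre_digraph \<Rightarrow> nat" where
  "chi_pcf G = (LEAST k. \<exists>f. proper_cf_coloring G f \<and> card (f ` pverts G) = k)"

text \<open>
  On finite simple graphs both minima range over a nonempty set: a coloring with pairwise distinct
  colors is proper conflict-free, and every proper conflict-free coloring is proper odd.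
\<close>

lemma proper_cf_imp_odd: "proper_cf_coloring G f \<Longrightarrow> proper_odd_coloring G f"
  unfolding proper_cf_coloring_def proper_odd_coloring_def by (metis odd_one)

lemma proper_cf_coloring_exists:
  assumes "pair_graph G"
  shows "\<exists>f. proper_cf_coloring G f"
proof -
  interpret pair_graph G by fact
  obtain f :: "'a \<Rightarrow> nat" where f: "inj_on f (pverts G)"
    using finite_imp_inj_to_nat_seg[OF pair_finite_verts] by blast
  have "f u \<noteq> f v" if "(u, v) \<in> parcs G" for u v
    using that f in_arcsD1[OF that] in_arcsD2[OF that] pair_no_loops[OF that]
    by (auto dest: inj_onD)
  moreover have "\<exists>c. card {u \<in> nbhd G v. f u = c} = 1" if "nbhd G v \<noteq> {}" for v
  proof -
    obtain w where w: "w \<in> nbhd G v" using \<open>nbhd G v \<noteq> {}\<close> by blast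
    have "nbhd G v \<subseteq> pverts G" unfolding nbhd_def by (auto dest: in_arcsD2)
    then have "{u \<in> nbhd G v. f u = f w} = {w}" using w f by (auto dest: inj_onD)
    then show ?thesis by (intro exI[of _ "f w"]) simp
  qed
  ultimately have "proper_cf_coloring G f"
    unfolding proper_cf_coloring_def proper_coloring_def by auto
  then show ?thesis by blast
qed

end

theory Submission
  imports Defs "HOL-Library.Nat_Bijection"
begin

text \<open>
  Both classes consist of incidence graphs between the points \<open>0, \<dots>, n - 1\<close> and a family of intervals
  of points.

  For the family of all intervals, an odd coloring assigns to each prefix of the points the set of
  colors that occur an odd number of times in it. Two prefixes with the same set would leave an
  interval between them in which every color is even, so \<open>k\<close> colors require \<open>n + 1 \<le> 2 ^ k\<close>.

  For the laminar family of dyadic intervals, a conflict-free coloring needs one more color for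
  each level, because a color that is unique in a block is absent from one of its halves. Odd
  colorings need only three colors on the points, since the parity vectors can be arranged so that
  every block is the sum of two different ones. Vertical chords for the points and chords below
  arcs for the intervals give a circle model of any laminar family.
\<close>

section \<open>Interval graphs\<close>

text \<open>Points and intervals share the vertex type \<open>nat\<close>, so that graphs of all
  sizes form one class.\<close>

definition pt :: "nat \<Rightarrow> nat" where
  "pt p = sum_encode (Inl p)"

definition iv :: "nat \<times> nat \<Rightarrow> nat" where
  "iv I = sum_encode (Inr (prod_encode I))"

definition case_vertex :: "(nat \<Rightarrow> 'b) \<Rightarrow> (nat \<times> nat \<Rightarrow> 'b) \<Rightarrow> nat \<Rightarrow> 'b" where
  "case_vertex f g v = (case sum_decode v of Inl p \<Rightarrow> f p | Inr c \<Rightarrow> g (prod_decode c))"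

lemma case_vertex_simps [simp]:
  "case_vertex f g (pt p) = f p" "case_vertex f g (iv I) = g I"
  by (simp_all add: case_vertex_def pt_def iv_def)

lemma pt_iv_simps [simp]:
  "pt p = pt q \<longleftrightarrow> p = q" "iv I = iv J \<longleftrightarrow> I = J" "pt p \<noteq> iv I" "iv I \<noteq> pt p"
  by (simp_all add: pt_def iv_def sum_encode_eq prod_encode_eq)

definition interval_graph :: "nat \<Rightarrow> (nat \<times> nat) set \<Rightarrow> nat pair_pre_digraph" where
  "interval_graph n J =
    \<lparr>pverts = pt ` {..<n} \<union> iv ` J,
     parcs = {(pt p, iv (l, r)) | p l r. (l, r) \<in> J \<and> l \<le> p \<and> p \<le> r} \<union>
             {(iv (l, r), pt p) | p l r. (l, r) \<in> J \<and> l \<le> p \<and> p \<le> r}\<rparr>"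

section \<open>Unbounded suprema and attained chromatic numbers\<close>

lemma SUP_enat_eq_infinity:
  assumes "\<And>k. \<exists>x\<in>S. k \<le> f x"
  shows "(SUP x\<in>S. enat (f x)) = \<infinity>"
proof (rule ccontr)
  assume "(SUP x\<in>S. enat (f x)) \<noteq> \<infinity>"
  then obtain m where m: "(SUP x\<in>S. enat (f x)) = enat m" by auto
  obtain x where "x \<in> S" "Suc m \<le> f x" using assms by blast
  then have "enat (Suc m) \<le> (SUP x\<in>S. enat (f x))"
    by (meson SUP_upper2 enat_ord_simps(1))
  then show False using m by simp
qed

text \<open>Turns a lower bound valid for every odd coloring into one for \<open>chi_o\<close>; the
  minimum exists because a conflict-free coloring does.\<close>

lemma chi_o_attained:
  assumes "pair_graph G"
  obtains f where "proper_odd_coloring G f" "card (f ` pverts G) = chi_o G"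
proof -
  obtain f where "proper_odd_coloring G f"
    using proper_cf_coloring_exists[OF assms] proper_cf_imp_odd by blast
  then have "\<exists>k f. proper_odd_coloring G f \<and> card (f ` pverts G) = k" by blast
  from LeastI_ex[OF this] show ?thesis using that unfolding chi_o_def by blast
qed

lemma chi_pcf_attained:
  assumes "pair_graph G"
  obtains f where "proper_cf_coloring G f" "card (f ` pverts G) = chi_pcf G"
proof -
  have "\<exists>k f. proper_cf_coloring G f \<and> card (f ` pverts G) = k"
    using proper_cf_coloring_exists[OF assms] by blast
  from LeastI_ex[OF this] show ?thesis using that unfolding chi_pcf_def by blast
qed

lemma chi_o_le: "proper_odd_coloring G f \<Longrightarrow> chi_o G \<le> card (f ` pverts G)"
  unfolding chi_o_def by (rule Least_le) blast

section \<open>Axis-parallel segments\<close>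

lemma closed_segment_horizontal:
  fixes a b c :: real
  assumes "a \<le> b"
  shows "closed_segment (a, c) (b, c) = {a..b} \<times> {c}"
proof -
  have "(x, c) \<in> closed_segment (a, c) (b, c)" if x: "a \<le> x" "x \<le> b" for x
  proof -
    obtain u where "x = (1 - u) *\<^sub>R a + u *\<^sub>R b" "0 \<le> u" "u \<le> 1"
      using x assms by (metis atLeastAtMost_iff closed_segment_eq_real_ivl1 in_segment(1))
    then show ?thesis
      unfolding in_segment by (intro exI[of _ u]) (auto simp: algebra_simps)
  qed
  then show ?thesis
    using assms by (auto dest!: closed_segment_PairD simp: closed_segment_eq_real_ivl)
qed

lemma closed_segment_vertical:
  fixes a b c :: real
  assumes "a \<le> b"
  shows "closed_segment (c, a) (c, b) = {c} \<times> {a..b}"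
proof -
  have "(c, x) \<in> closed_segment (c, a) (c, b)" if x: "a \<le> x" "x \<le> b" for x
  proof -
    obtain u where "x = (1 - u) *\<^sub>R a + u *\<^sub>R b" "0 \<le> u" "u \<le> 1"
      using x assms by (metis atLeastAtMost_iff closed_segment_eq_real_ivl1 in_segment(1))
    then show ?thesis
      unfolding in_segment by (intro exI[of _ u]) (auto simp: algebra_simps)
  qed
  then show ?thesis
    using assms by (auto dest!: closed_segment_PairD simp: closed_segment_eq_real_ivl)
qed

text \<open>By nondegeneracy a horizontal segment has two points with different first coordinates,
  while on a vertical one this coordinate is constant.\<close>

lemma not_horizontal_and_vertical:
  assumes "horizontal_segment S"
  shows "\<not> vertical_segment S"
proof
  assume "vertical_segment S"
  then obtain a b c a' b' c' where ab: "a < b" "a' < b'"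
    and S: "S = {a..b} \<times> {c}" "S = {c'} \<times> {a'..b'}"
    using assms unfolding horizontal_segment_def vertical_segment_def
    by (metis closed_segment_horizontal closed_segment_vertical less_imp_le)
  have "(a, c) \<in> S" "(b, c) \<in> S" using S(1) ab by auto
  then show False using S(2) ab by simp
qed

section \<open>Linear orders from sort keys\<close>

lemma linear_order_on_inv_image:
  fixes key :: "'a \<Rightarrow> 'b::linorder"
  assumes "inj_on key V"
  shows "linear_order_on V {(u, v). u \<in> V \<and> v \<in> V \<and> key u \<le> key v}"
  using assms
  unfolding linear_order_on_def partial_order_on_def preorder_on_def refl_on_def trans_def
    antisym_def total_on_def inj_on_def
  by (auto intro: order_trans)

text \<open>Two-digit numbers in base \<open>m\<close> compare lexicographically; this lets one
  integer serve as a sort key with a tie-breaker.\<close>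

lemma lex_le_iff:
  fixes a b x y m :: int
  assumes "0 \<le> x" "x < m" "0 \<le> y" "y < m"
  shows "a * m + x \<le> b * m + y \<longleftrightarrow> a < b \<or> a = b \<and> x \<le> y"
proof -
  have less: "c * m + z < d * m + w" if "c < d" "z < m" "0 \<le> w" for c d z w :: int
  proof -
    have "(c + 1) * m \<le> d * m" using that assms by (intro mult_right_mono) auto
    then show ?thesis using that by (simp add: algebra_simps)
  qed
  show ?thesis
    using less[of a b x y] less[of b a y x] assms by (cases a b rule: linorder_cases) auto
qed

section \<open>Chords of the lower half circle\<close>

text \<open>
  The point \<open>(xc t, yc t)\<close> of the unit circle is the stereographic parametrization, turned so that
  \<open>-1 < t < 1\<close> describes the open lower half circle from left to right.
\<close>

definition xc :: "real \<Rightarrow> real" where "xc t = 2 * t / (1 + t\<^sup>2)"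

definition yc :: "real \<Rightarrow> real" where "yc t = (t\<^sup>2 - 1) / (1 + t\<^sup>2)"

lemma one_plus_square_pos: "0 < 1 + (t::real)\<^sup>2"
  by (simp add: add_pos_nonneg)

lemma xc_yc_circle: "(xc t)\<^sup>2 + (yc t)\<^sup>2 = 1"
proof -
  have "(2 * t)\<^sup>2 + (t\<^sup>2 - 1)\<^sup>2 = (1 + t\<^sup>2)\<^sup>2" by algebra
  then show ?thesis
    using one_plus_square_pos[of t]
    by (simp add: xc_def yc_def power_divide add_divide_distrib[symmetric])
qed

lemma yc_neg: "\<bar>t\<bar> < 1 \<Longrightarrow> yc t < 0"
  using one_plus_square_pos[of t] abs_square_less_1[of t]
  by (simp add: yc_def divide_neg_pos)

text \<open>Over a common denominator the difference has numerator
  \<open>2 * (t - s) * (1 - s * t)\<close>, whose last factor is positive inside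
  \<open>(-1, 1)\<close>.\<close>

lemma xc_less:
  assumes "\<bar>s\<bar> < 1" "\<bar>t\<bar> < 1" "s < t"
  shows "xc s < xc t"
proof -
  have "\<bar>s * t\<bar> < 1"
    using assms by (metis abs_ge_zero abs_mult mult_strict_mono' mult_1)
  then have "0 < (t - s) * (1 - s * t)" using assms by (intro mult_pos_pos) auto
  also have "2 * ((t - s) * (1 - s * t)) = 2 * t * (1 + s\<^sup>2) - 2 * s * (1 + t\<^sup>2)" by algebra
  finally show ?thesis
    using one_plus_square_pos[of s] one_plus_square_pos[of t]
    by (simp add: xc_def divide_simps)
qed

lemma xc_inj: "xc s = xc t \<Longrightarrow> \<bar>s\<bar> < 1 \<Longrightarrow> \<bar>t\<bar> < 1 \<Longrightarrow> s = t"
  using xc_less[of s t] xc_less[of t s] by (cases s t rule: linorder_cases) auto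

lemma xc_le_iff: "\<bar>s\<bar> < 1 \<Longrightarrow> \<bar>t\<bar> < 1 \<Longrightarrow> xc s \<le> xc t \<longleftrightarrow> s \<le> t"
  using xc_less[of s t] xc_less[of t s] by (cases s t rule: linorder_cases) auto

text \<open>Projection to the first coordinate gives one direction. Conversely, the point of the arc
  chord at abscissa \<open>xc u\<close> lies in the disc, and the vertical chord is the whole slice
  of the disc there.\<close>

lemma vertical_chord_meets_arc_chord:
  assumes "\<bar>s\<bar> < 1" "\<bar>t\<bar> < 1" "\<bar>u\<bar> < 1" "s < t"
  shows "closed_segment (xc u, yc u) (xc u, - yc u) \<inter> closed_segment (xc s, yc s) (xc t, yc t) \<noteq> {}
    \<longleftrightarrow> s \<le> u \<and> u \<le> t" (is "?V \<inter> ?C \<noteq> {} \<longleftrightarrow> _")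
proof
  assume "?V \<inter> ?C \<noteq> {}"
  then have "xc u \<in> closed_segment (xc s) (xc t)" by (auto dest!: closed_segment_PairD)
  then show "s \<le> u \<and> u \<le> t"
    using xc_less[of s t] assms by (simp add: closed_segment_eq_real_ivl xc_le_iff)
next
  assume "s \<le> u \<and> u \<le> t"
  then have "xc u \<in> closed_segment (xc s) (xc t)"
    using xc_less[of s t] assms by (simp add: closed_segment_eq_real_ivl xc_le_iff)
  then obtain w where w: "xc u = (1 - w) *\<^sub>R xc s + w *\<^sub>R xc t" "0 \<le> w" "w \<le> 1"
    unfolding in_segment by blast
  define y where "y = (1 - w) *\<^sub>R yc s + w *\<^sub>R yc t"
  have C: "(xc u, y) \<in> ?C"
    unfolding in_segment using w by (intro exI[of _ w]) (simp add: y_def)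
  have "?C \<subseteq> cball (0, 0) 1"
    by (rule closed_segment_subset) (simp_all add: dist_Pair_Pair xc_yc_circle)
  with C have "(xc u)\<^sup>2 + y\<^sup>2 \<le> 1" by (auto simp: dist_Pair_Pair)
  then have "y\<^sup>2 \<le> (yc u)\<^sup>2" using xc_yc_circle[of u] by simp
  then have "\<bar>y\<bar> \<le> \<bar>yc u\<bar>" by (simp add: abs_le_square_iff)
  then have "y \<in> {yc u..- yc u}" using yc_neg[OF assms(3)] by auto
  then have "(xc u, y) \<in> ?V" using yc_neg[OF assms(3)] by (simp add: closed_segment_vertical)
  with C show "?V \<inter> ?C \<noteq> {}" by blast
qed

text \<open>The projections to the first coordinate are already disjoint.\<close>

lemma arc_chords_apart:
  assumes "\<bar>s\<bar> < 1" "\<bar>t\<bar> < 1" "\<bar>s'\<bar> < 1" "\<bar>t'\<bar> < 1" "s < t" "t < s'" "s' < t'"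
  shows "closed_segment (xc s, yc s) (xc t, yc t) \<inter> closed_segment (xc s', yc s') (xc t', yc t') = {}"
  using assms xc_less[of s t] xc_less[of t s'] xc_less[of s' t']
  by (fastforce dest!: closed_segment_PairD simp: closed_segment_eq_real_ivl)

text \<open>The line through the ends of the outer chord has the inner chord strictly on one
  side.\<close>

lemma arc_chords_nested:
  assumes "s < s'" "s' < t'" "t' < t"
  shows "closed_segment (xc s, yc s) (xc t, yc t) \<inter> closed_segment (xc s', yc s') (xc t', yc t') = {}"
proof -
  \<comment> \<open>\<open>g = 0\<close> is the line through the points with parameters \<open>s\<close> and \<open>t\<close>.\<close>
  define g where "g = (\<lambda>(x, y). (s + t) * x - (1 - s * t) * y - (1 + s * t))"
  have g_arc: "g (xc u, yc u) = 2 * ((t - u) * (u - s)) / (1 + u\<^sup>2)" for u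
  proof -
    have "(s + t) * (2 * u) - (1 - s * t) * (u\<^sup>2 - 1) - (1 + s * t) * (1 + u\<^sup>2) = 2 * ((t - u) * (u - s))"
      by algebra
    moreover have "xc u * (1 + u\<^sup>2) = 2 * u" "yc u * (1 + u\<^sup>2) = u\<^sup>2 - 1"
      using one_plus_square_pos[of u] by (simp_all add: xc_def yc_def)
    ultimately have "g (xc u, yc u) * (1 + u\<^sup>2) = 2 * ((t - u) * (u - s))"
      unfolding g_def prod.case left_diff_distrib mult.assoc by simp
    then show ?thesis
      using one_plus_square_pos[of u] by (simp add: eq_divide_eq)
  qed
  have g_affine: "g ((1 - w) *\<^sub>R p + w *\<^sub>R q) = (1 - w) * g p + w * g q" for w p q
    by (cases p; cases q) (simp add: g_def algebra_simps)
  have "g z = 0" if "z \<in> closed_segment (xc s, yc s) (xc t, yc t)" for z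
    using that unfolding in_segment by (auto simp del: scaleR_Pair simp: g_affine g_arc)
  moreover have "0 < g z" if z: "z \<in> closed_segment (xc s', yc s') (xc t', yc t')" for z
  proof -
    have pos: "0 < g (xc s', yc s')" "0 < g (xc t', yc t')"
      unfolding g_arc using assms one_plus_square_pos
      by (auto intro!: divide_pos_pos mult_pos_pos)
    obtain w where w: "z = (1 - w) *\<^sub>R (xc s', yc s') + w *\<^sub>R (xc t', yc t')" "0 \<le> w" "w \<le> 1"
      using z unfolding in_segment by blast
    \<comment> \<open>For \<open>w = 0\<close> the second summand vanishes and the first one is
      positive; otherwise the second one is.\<close>
    have "0 < (1 - w) * g (xc s', yc s') + w * g (xc t', yc t')"
      using w pos by (cases "w = 0") (auto intro: add_nonneg_pos)
    then show ?thesis unfolding w(1) g_affine .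
  qed
  ultimately show ?thesis by fastforce
qed

section \<open>Geometric and order models\<close>

text \<open>Nonempty intervals keep the interval vertices from being isolated; the bound
  \<open>n\<close> makes \<open>J\<close> finite.\<close>

locale interval_family =
  fixes n :: nat and J :: "(nat \<times> nat) set"
  assumes interval: "(l, r) \<in> J \<Longrightarrow> l \<le> r \<and> r < n"
begin

abbreviation "G \<equiv> interval_graph n J"

lemma finite_J: "finite J"
  by (rule finite_subset[of _ "{..<n} \<times> {..<n}"]) (auto dest: interval)

lemma pverts_G: "pverts G = pt ` {..<n} \<union> iv ` J"
  by (simp add: interval_graph_def)

lemma parcs_G [simp]:
  "(pt p, iv (l, r)) \<in> parcs G \<longleftrightarrow> (l, r) \<in> J \<and> l \<le> p \<and> p \<le> r"
  "(iv (l, r), pt p) \<in> parcs G \<longleftrightarrow> (l, r) \<in> J \<and> l \<le> p \<and> p \<le> r"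
  "(pt p, pt q) \<notin> parcs G" "(iv I, iv K) \<notin> parcs G"
  by (auto simp: interval_graph_def)

lemma parcs_subset: "parcs G \<subseteq> pt ` {..<n} \<times> iv ` J \<union> iv ` J \<times> pt ` {..<n}"
  using interval by (fastforce simp: interval_graph_def)

lemma pair_graph_G: "pair_graph G"
proof
  show "fst e \<in> pverts G" "snd e \<in> pverts G" if "e \<in> parcs G" for e
    using that parcs_subset pverts_G by auto
  show "finite (pverts G)" using finite_J by (simp add: pverts_G)
  show "finite (parcs G)"
    by (rule finite_subset[OF parcs_subset]) (simp add: finite_J)
  show "fst e \<noteq> snd e" if "e \<in> parcs G" for e
    using that parcs_subset by auto
  show "symmetric (with_proj G)"
    unfolding symmetric_def by (rule symI) (auto simp: arcs_ends_def arc_to_ends_def interval_graph_def)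
qed

lemma nbhd_iv: "(l, r) \<in> J \<Longrightarrow> nbhd G (iv (l, r)) = pt ` {l..r}"
  by (auto simp: nbhd_def interval_graph_def)

lemma nbhd_pt: "nbhd G (pt p) = iv ` {(l, r) \<in> J. l \<le> p \<and> p \<le> r}"
  by (auto simp: nbhd_def interval_graph_def)

lemma card_nbhd_iv:
  assumes "(l, r) \<in> J"
  shows "card {u \<in> nbhd G (iv (l, r)). f u = c} = card {p \<in> {l..r}. f (pt p) = c}"
proof -
  have "{u \<in> nbhd G (iv (l, r)). f u = c} = pt ` {p \<in> {l..r}. f (pt p) = c}"
    using nbhd_iv[OF assms] by auto
  then show ?thesis by (simp add: card_image inj_on_def)
qed

lemma bipartition_G: "bipartition G (pt ` {..<n}) (iv ` J)"
  using parcs_subset by (auto simp: bipartition_def pverts_G)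

lemma bipartite_G: "bipartite G"
  using bipartition_G unfolding bipartite_def by blast

lemma vertex_pair_cases:
  assumes "u \<in> pverts G" "v \<in> pverts G" "u \<noteq> v"
  obtains (points) p q where "u = pt p" "v = pt q" "p < n" "q < n" "p \<noteq> q"
    | (intervals) l r l' r' where "u = iv (l, r)" "v = iv (l', r')" "(l, r) \<in> J" "(l', r') \<in> J"
        "(l, r) \<noteq> (l', r')"
    | (point_interval) p l r where "u = pt p" "v = iv (l, r)" "p < n" "(l, r) \<in> J"
    | (interval_point) p l r where "u = iv (l, r)" "v = pt p" "p < n" "(l, r) \<in> J"
  using assms unfolding pverts_G by auto

text \<open>Shared by the grid model and the circle model.\<close>

lemma intersection_modelI:
  assumes points: "\<And>p q. p < n \<Longrightarrow> q < n \<Longrightarrow> p \<noteq> q \<Longrightarrow> S (pt p) \<inter> S (pt q) = {}"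
    and intervals: "\<And>I K. I \<in> J \<Longrightarrow> K \<in> J \<Longrightarrow> I \<noteq> K \<Longrightarrow> S (iv I) \<inter> S (iv K) = {}"
    and mixed: "\<And>p l r. p < n \<Longrightarrow> (l, r) \<in> J \<Longrightarrow>
      S (pt p) \<inter> S (iv (l, r)) \<noteq> {} \<longleftrightarrow> l \<le> p \<and> p \<le> r"
  shows "intersection_model G S"
  unfolding intersection_model_def
proof (intro ballI impI)
  fix u v assume "u \<in> pverts G" "v \<in> pverts G" "u \<noteq> v"
  then show "(u, v) \<in> parcs G \<longleftrightarrow> S u \<inter> S v \<noteq> {}"
    by (cases rule: vertex_pair_cases)
      (simp_all add: points intervals mixed Int_commute[of "S (iv _)" "S (pt _)"])
qed

lemma convex_bipartite_G: "convex_bipartite G"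
proof -
  let ?r = "{(u, v). u \<in> pt ` {..<n} \<and> v \<in> pt ` {..<n} \<and> inv pt u \<le> inv pt v}"
  have inj: "inj pt" by (simp add: inj_on_def)
  have "linear_order_on (pt ` {..<n}) ?r"
    by (rule linear_order_on_inv_image) (auto simp: inj_on_def inv_f_f[OF inj])
  moreover have "consecutive ?r (nbhd G w)" if "w \<in> iv ` J" for w
    using that by (auto simp: consecutive_def nbhd_iv inv_f_f[OF inj])
  ultimately show ?thesis unfolding convex_bipartite_def using bipartition_G by blast
qed

lemma grid_intersection_graph_G: "grid_intersection_graph G"
proof -
  \<comment> \<open>Heights are distinct, so that horizontal segments are disjoint, and lie in
    \<open>(0, 1]\<close>, the range of the vertical ones.\<close>
  define h where "h I = 1 / (real (prod_encode I) + 1)" for I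
  \<comment> \<open>The overhang of \<open>1/4\<close> makes one-point intervals nondegenerate
    without reaching another integer abscissa.\<close>
  define S :: "nat \<Rightarrow> (real \<times> real) set" where
    "S = case_vertex (\<lambda>p. closed_segment (real p, 0) (real p, 1))
           (\<lambda>(l, r). closed_segment (real l - 1/4, h (l, r)) (real r + 1/4, h (l, r)))"
  have h: "0 < h I" "h I \<le> 1" for I by (auto simp: h_def)
  have h_inj: "h I = h K \<longleftrightarrow> I = K" for I K
    by (auto simp: h_def field_simps)
  have S_pt: "S (pt p) = {real p} \<times> {0..1}" for p
    by (simp add: S_def closed_segment_vertical)
  have S_iv: "S (iv (l, r)) = {real l - 1/4..real r + 1/4} \<times> {h (l, r)}" if "(l, r) \<in> J" for l r
    using interval[OF that] by (auto simp: S_def closed_segment_horizontal)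
  have vert: "vertical_segment (S (pt p))" for p
    unfolding S_def vertical_segment_def
    by (rule exI[of _ 0], rule exI[of _ 1], rule exI[of _ "real p"]) simp
  have hor: "horizontal_segment (S (iv (l, r)))" if "(l, r) \<in> J" for l r
    unfolding S_def horizontal_segment_def
    by (rule exI[of _ "real l - 1/4"], rule exI[of _ "real r + 1/4"], rule exI[of _ "h (l, r)"])
       (use interval[OF that] in auto)
  have pp: "S (pt p) \<inter> S (pt q) = {}" if "p \<noteq> q" for p q
    using that by (auto simp: S_pt)
  have ii: "S (iv I) \<inter> S (iv K) = {}" if "I \<noteq> K" "I \<in> J" "K \<in> J" for I K
    using that by (cases I; cases K) (auto simp: S_iv h_inj)
  have pi: "S (pt p) \<inter> S (iv (l, r)) \<noteq> {} \<longleftrightarrow> l \<le> p \<and> p \<le> r" if J: "(l, r) \<in> J" for p l r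
  proof -
    have "S (pt p) \<inter> S (iv (l, r)) \<noteq> {} \<longleftrightarrow> real l - 1/4 \<le> real p \<and> real p \<le> real r + 1/4"
      using h[of "(l, r)"] by (simp add: S_pt S_iv[OF J] Times_Int_Times less_imp_le)
    also have "\<dots> \<longleftrightarrow> l \<le> p \<and> p \<le> r" by linarith
    finally show ?thesis .
  qed
  have "intersection_model G S"
    by (rule intersection_modelI) (simp_all add: pp ii pi)
  moreover have "horizontal_segment (S v) \<or> vertical_segment (S v)" if "v \<in> pverts G" for v
    using that hor vert by (auto simp: pverts_G)
  moreover have "S u \<inter> S v = {}"
    if "u \<in> pverts G" "v \<in> pverts G" "u \<noteq> v"
      "horizontal_segment (S u) \<and> horizontal_segment (S v) \<or>
       vertical_segment (S u) \<and> vertical_segment (S v)" for u v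
    using that(1-3)
  proof (cases rule: vertex_pair_cases)
    case points
    then show ?thesis by (simp add: pp)
  next
    case intervals
    then show ?thesis by (simp add: ii)
  qed (use that(4) vert hor not_horizontal_and_vertical in blast)+
  ultimately show ?thesis
    unfolding grid_intersection_graph_def using bipartite_G by blast
qed

text \<open>The poset puts each point below the intervals containing it. For a point and an
  interval, \<open>k1\<close> and \<open>k2\<close> test the right and the left end. Points are
  reversed between \<open>k1\<close> and \<open>k2\<close>; for intervals these two agree only on
  inclusion, which \<open>k3\<close> reverses.\<close>

lemma comparability_graph_3dim_G: "comparability_graph_3dim G"
proof -
  \<comment> \<open>Every second digit below is at most \<open>n\<close>; the value \<open>n\<close>
    is reached by \<open>int r + 1\<close> when \<open>r = n - 1\<close>.\<close>
  define m where "m = int n + 1"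
  \<comment> \<open>\<open>k1\<close> and \<open>k2\<close> sort by right endpoints and by decreasing left endpoints, a point preceding the
    intervals that end there; \<open>k3\<close> has all points first and reverses inclusion of intervals.\<close>
  define k1 k2 k3 :: "nat \<Rightarrow> int" where
    "k1 = case_vertex (\<lambda>p. int p * m + 0) (\<lambda>(l, r). int r * m + (int l + 1))" and
    "k2 = case_vertex (\<lambda>p. - int p * m + 0) (\<lambda>(l, r). - int l * m + (int r + 1))" and
    "k3 = case_vertex (\<lambda>p. (- 1) * m + int p) (\<lambda>(l, r). (int n - (int r - int l)) * m + int l)"
  define L where "L k = {(u, v). u \<in> pverts G \<and> v \<in> pverts G \<and> k u \<le> k v}" for k :: "nat \<Rightarrow> int"
  have less_m: "0 \<le> int l" "int l + 1 < m" "0 \<le> int r" "int r + 1 < m" "int l < m" "int l \<le> int r"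
    "int r - int l < int n"
    if "(l, r) \<in> J" for l r using interval[OF that] by (auto simp: m_def)
  have less_m': "int p < m" if "p < n" for p using that by (simp add: m_def)
  have m: "0 < m" by (simp add: m_def)
  \<comment> \<open>Only the case distinctions are unfolded, so that the keys keep the shape
    \<open>a * m + x\<close> of \<open>lex_le_iff\<close>, even for \<open>x = 0\<close>.\<close>
  note unf = case_vertex_simps prod.case
  have k1: "k1 (pt p) \<le> k1 (pt q) \<longleftrightarrow> p \<le> q"
    "(l, r) \<in> J \<Longrightarrow> k1 (pt p) \<le> k1 (iv (l, r)) \<longleftrightarrow> p \<le> r"
    "(l, r) \<in> J \<Longrightarrow> k1 (iv (l, r)) \<le> k1 (pt p) \<longleftrightarrow> r < p"
    "(l, r) \<in> J \<Longrightarrow> (l', r') \<in> J \<Longrightarrow> k1 (iv (l, r)) \<le> k1 (iv (l', r')) \<longleftrightarrow> r < r' \<or> r = r' \<and> l \<le> l'"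
    for p q l r l' r'
    unfolding k1_def unf using less_m[of l r] less_m[of l' r'] m by (subst lex_le_iff; auto)+
  have k2: "k2 (pt p) \<le> k2 (pt q) \<longleftrightarrow> q \<le> p"
    "(l, r) \<in> J \<Longrightarrow> k2 (pt p) \<le> k2 (iv (l, r)) \<longleftrightarrow> l \<le> p"
    "(l, r) \<in> J \<Longrightarrow> k2 (iv (l, r)) \<le> k2 (pt p) \<longleftrightarrow> p < l"
    "(l, r) \<in> J \<Longrightarrow> (l', r') \<in> J \<Longrightarrow> k2 (iv (l, r)) \<le> k2 (iv (l', r')) \<longleftrightarrow> l' < l \<or> l = l' \<and> r \<le> r'"
    for p q l r l' r'
    unfolding k2_def unf using less_m[of l r] less_m[of l' r'] m by (subst lex_le_iff; auto)+
  have k3: "p < n \<Longrightarrow> q < n \<Longrightarrow> k3 (pt p) \<le> k3 (pt q) \<longleftrightarrow> p \<le> q"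
    "p < n \<Longrightarrow> (l, r) \<in> J \<Longrightarrow> k3 (pt p) \<le> k3 (iv (l, r))"
    "p < n \<Longrightarrow> (l, r) \<in> J \<Longrightarrow> \<not> k3 (iv (l, r)) \<le> k3 (pt p)"
    "(l, r) \<in> J \<Longrightarrow> (l', r') \<in> J \<Longrightarrow> k3 (iv (l, r)) \<le> k3 (iv (l', r')) \<longleftrightarrow>
      r' - l' < r - l \<or> r' - l' = r - l \<and> l \<le> l'"
    for p q l r l' r'
    unfolding k3_def unf using less_m[of l r] less_m[of l' r'] less_m'[of p] less_m'[of q]
    by (subst lex_le_iff; auto)+
  \<comment> \<open>The final \<open>metis\<close> step concerns \<open>k3\<close> on intervals:
    equal lengths and left ends give equal right ends, as \<open>l \<le> r\<close> prevents
    truncation in \<open>r - l\<close>.\<close>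
  have inj: "inj_on k1 (pverts G)" "inj_on k2 (pverts G)" "inj_on k3 (pverts G)"
    unfolding inj_on_def pverts_G order.eq_iff[of "_ :: int"]
    by (auto simp: k1 k2 k3) (metis interval eq_diff_iff)
  have rel: "(u, v) \<in> L k1 \<inter> L k2 \<inter> L k3 \<longleftrightarrow>
      u \<in> pverts G \<and> v \<in> pverts G \<and> (u = v \<or> (\<exists>p I. u = pt p \<and> v = iv I \<and> (u, v) \<in> parcs G))" for u v
  proof (cases "u \<in> pverts G \<and> v \<in> pverts G \<and> u \<noteq> v")
    case True
    then have "u \<in> pverts G" "v \<in> pverts G" "u \<noteq> v" by auto
    then have "k1 u \<le> k1 v \<and> k2 u \<le> k2 v \<and> k3 u \<le> k3 v \<longleftrightarrow>
      (\<exists>p I. u = pt p \<and> v = iv I \<and> (u, v) \<in> parcs G)"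
    proof (cases rule: vertex_pair_cases)
      case (intervals l r l' r')
      then show ?thesis
        using interval[OF intervals(3)] interval[OF intervals(4)] by (simp add: k1 k2 k3) linarith
    qed (auto simp: k1 k2 k3)
    then show ?thesis using True by (simp add: L_def)
  qed (auto simp: L_def)
  have lin: "linear_order_on (pverts G) (L k1)" "linear_order_on (pverts G) (L k2)"
    "linear_order_on (pverts G) (L k3)"
    unfolding L_def by (intro linear_order_on_inv_image inj)+
  let ?r = "L k1 \<inter> L k2 \<inter> L k3"
  have "partial_order_on (pverts G) ?r"
    using lin
    unfolding linear_order_on_def partial_order_on_def preorder_on_def refl_on_def
    by (auto intro!: trans_Int simp: antisym_def)
  moreover have "(u, v) \<in> parcs G \<longleftrightarrow> u \<noteq> v \<and> ((u, v) \<in> ?r \<or> (v, u) \<in> ?r)" for u v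
    unfolding rel using parcs_subset by (auto simp: pverts_G)
  ultimately have "comparability_graph_of G ?r" unfolding comparability_graph_of_def by blast
  then show ?thesis
    unfolding comparability_graph_3dim_def dim_at_most_3_def using lin by blast
qed

text \<open>Laminarity leaves only disjoint and nested arcs, and the chords below such arcs do not
  meet.\<close>

lemma circle_graph_G:
  assumes laminar: "\<And>l r l' r'. (l, r) \<in> J \<Longrightarrow> (l', r') \<in> J \<Longrightarrow>
    r < l' \<or> r' < l \<or> l \<le> l' \<and> r' \<le> r \<or> l' \<le> l \<and> r \<le> r'"
  shows "circle_graph G"
proof -
  \<comment> \<open>Rescales positions between \<open>-1\<close> and \<open>n\<close> into the
    parameter range of the lower half circle.\<close>
  define \<tau> where "\<tau> z = z / (real n + 1)" for z :: real
  \<comment> \<open>Intervals are extended by an amount increasing in their length, so that nested ones do not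
    share an endpoint.\<close>
  define \<delta> where "\<delta> l r = (real r - real l + 1) / (2 * (real n + 1))" for l r :: nat
  define a b where "a l r = \<tau> (real l - \<delta> l r)" and "b l r = \<tau> (real r + \<delta> l r)" for l r
  define S where
    "S = case_vertex (\<lambda>p. closed_segment (xc (\<tau> p), yc (\<tau> p)) (xc (\<tau> p), - yc (\<tau> p)))
           (\<lambda>(l, r). closed_segment (xc (a l r), yc (a l r)) (xc (b l r), yc (b l r)))"
  have \<tau>_less: "\<tau> y < \<tau> z \<longleftrightarrow> y < z" and \<tau>_le: "\<tau> y \<le> \<tau> z \<longleftrightarrow> y \<le> z" for y z
    by (simp_all add: \<tau>_def divide_less_cancel divide_le_cancel)
  have \<tau>_range: "\<bar>\<tau> z\<bar> < 1" if "-1 < z" "z < real n" for z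
    using that by (simp add: \<tau>_def abs_less_iff divide_less_eq less_divide_eq)
  \<comment> \<open>Below one half, the extension covers no further integer position and keeps
    disjoint intervals apart.\<close>
  have \<delta>: "0 < \<delta> l r" "\<delta> l r < 1/2" if "(l, r) \<in> J" for l r
    using interval[OF that] by (auto simp: \<delta>_def divide_less_eq)
  have ab: "\<bar>a l r\<bar> < 1" "\<bar>b l r\<bar> < 1" "a l r < b l r" if "(l, r) \<in> J" for l r
  proof -
    have lr: "real l \<le> real r" "real r + 1 \<le> real n" using interval[OF that] by auto
    show "\<bar>a l r\<bar> < 1"
      unfolding a_def
    proof (rule \<tau>_range)
      show "- 1 < real l - \<delta> l r" "real l - \<delta> l r < real n"
        using lr \<delta>[OF that] of_nat_0_le_iff[of l] by linarith+
    qed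
    show "\<bar>b l r\<bar> < 1"
      unfolding b_def
    proof (rule \<tau>_range)
      show "- 1 < real r + \<delta> l r" "real r + \<delta> l r < real n"
        using lr \<delta>[OF that] of_nat_0_le_iff[of r] by linarith+
    qed
    show "a l r < b l r"
      unfolding a_def b_def \<tau>_less using lr \<delta>[OF that] by linarith
  qed
  have pt_range: "\<bar>\<tau> (real p)\<bar> < 1" if "p < n" for p
    using that by (intro \<tau>_range) auto
  have circle: "(xc t, yc t) \<in> sphere (0, 0) 1" "(xc t, - yc t) \<in> sphere (0, 0) 1" for t
    by (simp_all add: dist_Pair_Pair xc_yc_circle)
  have chord: "chord (0, 0) 1 (S v)" if v: "v \<in> pverts G" for v
  proof -
    consider p where "v = pt p" "p < n" | l r where "v = iv (l, r)" "(l, r) \<in> J"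
      using v by (auto simp: pverts_G)
    then show ?thesis
    proof cases
      case 1
      then have "S v = closed_segment (xc (\<tau> p), yc (\<tau> p)) (xc (\<tau> p), - yc (\<tau> p))"
        by (simp add: S_def)
      moreover have "(xc (\<tau> p), yc (\<tau> p)) \<noteq> (xc (\<tau> p), - yc (\<tau> p))"
        using yc_neg[OF pt_range[OF 1(2)]] by simp
      ultimately show ?thesis unfolding chord_def using circle by blast
    next
      case 2
      then have "S v = closed_segment (xc (a l r), yc (a l r)) (xc (b l r), yc (b l r))"
        by (simp add: S_def)
      moreover have "(xc (a l r), yc (a l r)) \<noteq> (xc (b l r), yc (b l r))"
        using xc_less[of "a l r" "b l r"] ab[OF 2(2)] by simp
      ultimately show ?thesis unfolding chord_def using circle by blast
    qed
  qed
  have pp: "S (pt p) \<inter> S (pt q) = {}" if "p \<noteq> q" "p < n" "q < n" for p q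
  proof -
    have "\<tau> p \<noteq> \<tau> q" using that by (simp add: \<tau>_def)
    then have "xc (\<tau> p) \<noteq> xc (\<tau> q)" using xc_inj pt_range that by blast
    then show ?thesis by (auto simp: S_def dest!: closed_segment_PairD)
  qed
  have ip: "S (pt p) \<inter> S (iv (l, r)) \<noteq> {} \<longleftrightarrow> l \<le> p \<and> p \<le> r" if "p < n" "(l, r) \<in> J" for p l r
  proof -
    have "S (pt p) \<inter> S (iv (l, r)) \<noteq> {} \<longleftrightarrow> a l r \<le> \<tau> p \<and> \<tau> p \<le> b l r"
      unfolding S_def using vertical_chord_meets_arc_chord[of "a l r" "b l r" "\<tau> p"] ab[OF that(2)]
        pt_range[OF that(1)] by simp
    also have "\<dots> \<longleftrightarrow> l \<le> p \<and> p \<le> r"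
      unfolding a_def b_def \<tau>_le using \<delta>[OF that(2)] by linarith
    finally show ?thesis .
  qed
  have apart: "S (iv (l, r)) \<inter> S (iv (l', r')) = {}"
    if "(l, r) \<in> J" "(l', r') \<in> J" "r < l'" for l r l' r'
  proof -
    have "b l r < a l' r'"
      unfolding a_def b_def \<tau>_less using \<delta>[OF that(1)] \<delta>[OF that(2)] that(3) by linarith
    then show ?thesis
      using arc_chords_apart[of "a l r" "b l r" "a l' r'" "b l' r'"] ab that by (simp add: S_def)
  qed
  have nested: "S (iv (l, r)) \<inter> S (iv (l', r')) = {}"
    if "(l, r) \<in> J" "(l', r') \<in> J" "l \<le> l'" "r' \<le> r" "(l, r) \<noteq> (l', r')" for l r l' r'
  proof -
    have "\<delta> l' r' < \<delta> l r"
      unfolding \<delta>_def using that by (intro divide_strict_right_mono) auto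
    then have "a l r < a l' r'" "b l' r' < b l r"
      unfolding a_def b_def \<tau>_less using that by auto
    then show ?thesis
      using arc_chords_nested[of "a l r" "a l' r'" "b l' r'" "b l r"] ab that by (simp add: S_def)
  qed
  have ii: "S (iv (l, r)) \<inter> S (iv (l', r')) = {}"
    if "(l, r) \<in> J" "(l', r') \<in> J" "(l, r) \<noteq> (l', r')" for l r l' r'
    using laminar[OF that(1,2)] apart[OF that(1,2)] apart[OF that(2,1)] nested[OF that(1,2)]
      nested[OF that(2,1)] that(3) by (metis Int_commute)
  have "intersection_model G S"
  proof (rule intersection_modelI)
    show "S (iv I) \<inter> S (iv K) = {}" if "I \<in> J" "K \<in> J" "I \<noteq> K" for I K
      using ii[of "fst I" "snd I" "fst K" "snd K"] that by simp
  qed (simp_all add: pp ip)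
  then show ?thesis unfolding circle_graph_def using chord zero_less_one by blast
qed

end

section \<open>Chromatic bounds\<close>

text \<open>There are \<open>n + 1\<close> prefixes, counting the empty one, and their parity
  vectors are distinct sets of colors; hence the strict inequality.\<close>

lemma all_intervals_odd_coloring_bound:
  assumes f: "proper_odd_coloring (interval_graph n {(l, r). l \<le> r \<and> r < n}) f"
  shows "n < 2 ^ card (f ` pverts (interval_graph n {(l, r). l \<le> r \<and> r < n}))"
proof -
  interpret interval_family n "{(l, r). l \<le> r \<and> r < n}" by unfold_locales auto
  define \<phi> where "\<phi> m = {c. odd (card {p \<in> {..<m}. f (pt p) = c})}" for m
  have "inj_on \<phi> {..n}"
  proof (rule linorder_inj_onI)
    fix i j assume ij: "i < j" "i \<in> {..n}" "j \<in> {..n}"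
    \<comment> \<open>The points by which the prefixes of lengths \<open>i\<close> and
      \<open>j\<close> differ.\<close>
    then have J: "(i, j - 1) \<in> {(l, r). l \<le> r \<and> r < n}" by auto
    then have "iv (i, j - 1) \<in> pverts G" "nbhd G (iv (i, j - 1)) \<noteq> {}"
      using ij by (auto simp: pverts_G nbhd_iv)
    then have "\<exists>c. odd (card {u \<in> nbhd G (iv (i, j - 1)). f u = c})"
      using f unfolding proper_odd_coloring_def by blast
    then obtain c where "odd (card {p \<in> {i..j - 1}. f (pt p) = c})"
      unfolding card_nbhd_iv[OF J] by blast
    moreover have "{p \<in> {..<j}. f (pt p) = c} =
        {p \<in> {..<i}. f (pt p) = c} \<union> {p \<in> {i..j - 1}. f (pt p) = c}"
      using ij by auto
    then have "card {p \<in> {..<j}. f (pt p) = c} =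
        card {p \<in> {..<i}. f (pt p) = c} + card {p \<in> {i..j - 1}. f (pt p) = c}"
      by (simp add: card_Un_disjoint disjoint_iff)
    ultimately have "c \<in> \<phi> i \<longleftrightarrow> c \<notin> \<phi> j" by (simp add: \<phi>_def)
    then show "\<phi> i \<noteq> \<phi> j" by blast
  qed auto
  moreover have "\<phi> ` {..n} \<subseteq> Pow (f ` pverts G)"
  proof (clarsimp simp: \<phi>_def)
    fix m c assume "m \<le> n" "odd (card {p. p < m \<and> f (pt p) = c})"
    then have "{p. p < m \<and> f (pt p) = c} \<noteq> {}" by force
    then show "c \<in> f ` pverts G" using \<open>m \<le> n\<close> by (auto simp: pverts_G)
  qed
  moreover have fin: "finite (f ` pverts G)" using finite_J by (simp add: pverts_G)
  ultimately have "card {..n} \<le> card (Pow (f ` pverts G))"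
    by (intro card_inj_on_le[of \<phi>]) auto
  then show ?thesis using fin by (simp add: card_Pow Suc_le_eq)
qed

section \<open>The laminar family of dyadic blocks\<close>

fun dyadic :: "nat \<Rightarrow> nat \<Rightarrow> (nat \<times> nat) set" where
  "dyadic 0 s = {(s, s)}"
| "dyadic (Suc d) s = insert (s, s + 2 ^ Suc d - 1) (dyadic d s \<union> dyadic d (s + 2 ^ d))"

lemma dyadic_bounds: "(l, r) \<in> dyadic d s \<Longrightarrow> s \<le> l \<and> l \<le> r \<and> r < s + 2 ^ d"
proof (induction d arbitrary: s)
  case (Suc d)
  \<comment> \<open>Exposes \<open>2 ^ d\<close> as a successor, so that the truncated subtraction
    in the right end is harmless.\<close>
  obtain k where "(2::nat) ^ d = Suc k" using not0_implies_Suc[of "2 ^ d"] by auto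
  then show ?case using Suc.prems Suc.IH[of s] Suc.IH[of "s + 2 ^ d"] by fastforce
qed simp

text \<open>Blocks are stored with inclusive ends; the half-open form splits into halves without
  subtraction.\<close>

lemma block_eq: "{s..s + 2 ^ d - 1} = {s..<s + 2 ^ d}" for s d :: nat
proof -
  obtain k where "(2::nat) ^ d = Suc k" using not0_implies_Suc[of "2 ^ d"] by auto
  then show ?thesis by auto
qed

lemma dyadic_root: "(s, s + 2 ^ d - 1) \<in> dyadic d s"
  by (cases d) auto

text \<open>The root contains every block. Two other blocks lie in different halves, hence are
  disjoint, or in the same half, where induction applies.\<close>

lemma dyadic_laminar:
  assumes "(l, r) \<in> dyadic d s" "(l', r') \<in> dyadic d s"
  shows "r < l' \<or> r' < l \<or> l \<le> l' \<and> r' \<le> r \<or> l' \<le> l \<and> r \<le> r'"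
  using assms
proof (induction d arbitrary: s)
  case (Suc d)
  note bounds = dyadic_bounds[OF Suc.prems(1)] dyadic_bounds[OF Suc.prems(2)]
  consider "(l, r) = (s, s + 2 ^ Suc d - 1)" | "(l', r') = (s, s + 2 ^ Suc d - 1)"
    | "(l, r) \<in> dyadic d s" "(l', r') \<in> dyadic d s"
    | "(l, r) \<in> dyadic d (s + 2 ^ d)" "(l', r') \<in> dyadic d (s + 2 ^ d)"
    | "(l, r) \<in> dyadic d s" "(l', r') \<in> dyadic d (s + 2 ^ d)"
    | "(l, r) \<in> dyadic d (s + 2 ^ d)" "(l', r') \<in> dyadic d s"
    using Suc.prems by auto
  then show ?case
  proof cases
    case 3
    then show ?thesis by (rule Suc.IH)
  next
    case 4
    then show ?thesis by (rule Suc.IH)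
  next
    case 5
    then show ?thesis using dyadic_bounds[OF 5(1)] dyadic_bounds[OF 5(2)] by linarith
  next
    case 6
    then show ?thesis using dyadic_bounds[OF 6(1)] dyadic_bounds[OF 6(2)] by linarith
  qed (use bounds in auto)
qed simp

lemma dyadic_conflict_free_bound:
  assumes "\<And>l r. (l, r) \<in> dyadic d s \<Longrightarrow> \<exists>c. card {p \<in> {l..r}. f p = c} = 1"
  shows "d < card (f ` {s..<s + 2 ^ d})"
  using assms
proof (induction d arbitrary: s)
  case (Suc d)
  let ?A = "{s..<s + 2 ^ d}" and ?B = "{s + 2 ^ d..<s + 2 ^ d + 2 ^ d}"
  obtain c where "card {p \<in> {s..<s + 2 ^ Suc d}. f p = c} = 1"
    using Suc.prems[OF dyadic_root] unfolding block_eq by blast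
  then obtain p where p: "{p \<in> {s..<s + 2 ^ Suc d}. f p = c} = {p}"
    by (auto simp: card_1_singleton_iff)
  have "p \<in> {p \<in> {s..<s + 2 ^ Suc d}. f p = c}" unfolding p by simp
  then have c: "c \<in> f ` {s..<s + 2 ^ Suc d}" by blast
  have whole: "{s..<s + 2 ^ Suc d} = ?A \<union> ?B" by auto
  have "d < card (f ` ?A)" "d < card (f ` ?B)"
    using Suc.prems by (auto intro!: Suc.IH)
  \<comment> \<open>Occurrences of \<open>c\<close> in both halves would be two different points,
    but \<open>p\<close> is the only one.\<close>
  moreover have "c \<notin> f ` ?A \<or> c \<notin> f ` ?B"
  proof (rule ccontr)
    assume "\<not> ?thesis"
    then obtain a b where "a \<in> ?A" "b \<in> ?B" "f a = c" "f b = c" by auto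
    moreover from this have "a \<in> {p}" "b \<in> {p}" unfolding p[symmetric] by auto
    ultimately show False by auto
  qed
  \<comment> \<open>\<open>X\<close> is the half that misses \<open>c\<close>; adding
    \<open>c\<close> to its colors gains one.\<close>
  ultimately obtain X where X: "d < card (f ` X)" "c \<notin> f ` X" "X \<subseteq> {s..<s + 2 ^ Suc d}"
    unfolding whole by blast
  have "finite X" using X(3) finite_subset by blast
  then have "Suc d < card (insert c (f ` X))" using X by simp
  also have "\<dots> \<le> card (f ` {s..<s + 2 ^ Suc d})"
    using X(3) c by (intro card_mono) auto
  finally show ?case .
qed simp

text \<open>
  The parity vector of a block is a unit vector of \<open>\<bbbF>\<^sub>2\<^sup>3\<close> for single points and the complement of one for
  longer blocks. As the sum of two distinct such vectors is the complement of the third one, a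
  block of either type splits into two halves of the other two types.
\<close>

definition odd_block_coloring :: "nat \<Rightarrow> nat \<Rightarrow> nat \<Rightarrow> (nat \<Rightarrow> nat) \<Rightarrow> bool" where
  "odd_block_coloring d s x g \<longleftrightarrow> range g \<subseteq> {..<3} \<and>
    (\<forall>c<3. odd (card {p \<in> {s..<s + 2 ^ d}. g p = c}) \<longleftrightarrow> (c = x \<longleftrightarrow> d = 0)) \<and>
    (\<forall>(l, r)\<in>dyadic d s. \<exists>c. odd (card {p \<in> {l..r}. g p = c}))"

lemma odd_block_coloringD:
  assumes "odd_block_coloring d s x g"
  shows "range g \<subseteq> {..<3}"
    and "c < 3 \<Longrightarrow> odd (card {p \<in> {s..<s + 2 ^ d}. g p = c}) \<longleftrightarrow> (c = x \<longleftrightarrow> d = 0)"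
    and "(l, r) \<in> dyadic d s \<Longrightarrow> \<exists>c. odd (card {p \<in> {l..r}. g p = c})"
  using assms unfolding odd_block_coloring_def by (simp, simp, fast)

text \<open>Induction with \<open>x\<close> arbitrary, since the halves use the two vectors other
  than that of the whole block.\<close>

lemma odd_block_coloring_exists:
  assumes "x < 3"
  shows "\<exists>g. odd_block_coloring d s x g"
  using assms
proof (induction d arbitrary: x s)
  case 0
  have point: "{p \<in> {s..<s + 2 ^ 0}. x = c} = (if c = x then {s} else {})"
    "{p \<in> {s..s}. x = c} = (if c = x then {s} else {})" for c by auto
  show ?case
    unfolding odd_block_coloring_def
  proof (intro exI[of _ "\<lambda>_. x"] conjI)
    show "\<forall>(l, r)\<in>dyadic 0 s. \<exists>c. odd (card {p \<in> {l..r}. x = c})"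
      unfolding dyadic.simps by (auto simp only: prod.case point intro!: exI[of _ x]) simp
    show "\<forall>c<3. odd (card {p \<in> {s..<s + 2 ^ 0}. x = c}) \<longleftrightarrow> (c = x \<longleftrightarrow> 0 = (0::nat))"
      unfolding point by simp
  qed (use 0 in auto)
next
  case (Suc d)
  consider "x = 0" | "x = 1" | "x = 2" using Suc.prems by linarith
  \<comment> \<open>\<open>y\<close> and \<open>z\<close> are the two other colors. The condition
    says that their unit vectors sum to the complement of that of \<open>x\<close>; complementing
    both summands leaves the sum unchanged.\<close>
  then obtain y z where xyz: "y < 3" "z < 3" "\<And>c. c < 3 \<Longrightarrow> (c = y) \<noteq> (c = z) \<longleftrightarrow> c \<noteq> x"
  proof cases
    case 1
    then show ?thesis by (intro that[of 1 2]) linarith+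
  next
    case 2
    then show ?thesis by (intro that[of 0 2]) linarith+
  next
    case 3
    then show ?thesis by (intro that[of 0 1]) linarith+
  qed
  let ?A = "{s..<s + 2 ^ d}" and ?B = "{s + 2 ^ d..<s + 2 ^ d + 2 ^ d}"
  obtain g1 g2 where "odd_block_coloring d s y g1" "odd_block_coloring d (s + 2 ^ d) z g2"
    using Suc.IH xyz(1,2) by blast
  note g1 = odd_block_coloringD[OF this(1)] and g2 = odd_block_coloringD[OF this(2)]
  define g where "g p = (if p < s + 2 ^ d then g1 p else g2 p)" for p
  have left: "{p \<in> {l..r}. g p = c} = {p \<in> {l..r}. g1 p = c}" if "(l, r) \<in> dyadic d s" for l r c
    using dyadic_bounds[OF that] by (auto simp: g_def)
  have right: "{p \<in> {l..r}. g p = c} = {p \<in> {l..r}. g2 p = c}"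
    if "(l, r) \<in> dyadic d (s + 2 ^ d)" for l r c
    using dyadic_bounds[OF that] by (auto simp: g_def)
  have "{p \<in> {s..<s + 2 ^ Suc d}. g p = c} = {p \<in> ?A. g1 p = c} \<union> {p \<in> ?B. g2 p = c}" for c
    by (auto simp: g_def)
  then have "card {p \<in> {s..<s + 2 ^ Suc d}. g p = c} =
      card {p \<in> ?A. g1 p = c} + card {p \<in> ?B. g2 p = c}" for c
    by (simp add: card_Un_disjoint disjoint_iff)
  then have whole: "odd (card {p \<in> {s..<s + 2 ^ Suc d}. g p = c}) \<longleftrightarrow> c \<noteq> x" if "c < 3" for c
    using g1(2)[OF that] g2(2)[OF that] xyz(3)[OF that] by auto
  \<comment> \<open>The complement of a unit vector is nonzero, so the whole block has an odd
    color.\<close>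
  have "\<exists>c<3. c \<noteq> x"
    by (rule exI[of _ "if x = 0 then 1 else 0"]) simp
  then have root: "\<exists>c. odd (card {p \<in> {s..s + 2 ^ Suc d - 1}. g p = c})"
    unfolding block_eq
    using whole by blast
  have "\<exists>c. odd (card {p \<in> {l..r}. g p = c})" if "(l, r) \<in> dyadic (Suc d) s" for l r
    using that root g1(3)[of l r] g2(3)[of l r] left[of l r] right[of l r] by auto
  moreover have "range g \<subseteq> {..<3}" using g1(1) g2(1) by (auto simp: g_def)
  ultimately have "odd_block_coloring (Suc d) s x g"
    using whole unfolding odd_block_coloring_def by blast
  then show ?case by blast
qed

section \<open>Chromatic numbers of the dyadic graphs\<close>

lemma interval_family_dyadic: "interval_family (2 ^ d) (dyadic d 0)"
  by unfold_locales (use dyadic_bounds in fastforce)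

text \<open>Three colors on the points satisfy the interval vertices. A private color for the root
  block, which contains all points, satisfies every point, and a fifth color serves the other
  blocks.\<close>

lemma chi_o_dyadic: "chi_o (interval_graph (2 ^ d) (dyadic d 0)) \<le> 5"
proof -
  interpret interval_family "2 ^ d" "dyadic d 0" by (rule interval_family_dyadic)
  obtain g where "odd_block_coloring d 0 0 g"
    using odd_block_coloring_exists[of 0 d 0] by auto
  note g = odd_block_coloringD[OF this]
  define R where "R = (0::nat, 2 ^ d - 1 :: nat)"
  have R: "R \<in> dyadic d 0" using dyadic_root[of 0 d] by (simp add: R_def)
  define f where "f = case_vertex g (\<lambda>I. if I = R then 3 else 4)"
  have g3: "g p < 3" for p using g(1) by auto
  have "proper_coloring G f"
    unfolding proper_coloring_def
  proof clarify
    fix u v assume uv: "(u, v) \<in> parcs G" "f u = f v"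
    have "g p \<noteq> 3" "g p \<noteq> 4" for p using g3[of p] by auto
    then show False
      using subsetD[OF parcs_subset uv(1)] uv(2) by (auto simp: f_def eq_commute split: if_splits)
  qed
  moreover have "\<exists>c. odd (card {u \<in> nbhd G v. f u = c})" if v: "v \<in> pverts G" for v
  proof -
    consider p where "v = pt p" "p < 2 ^ d" | l r where "v = iv (l, r)" "(l, r) \<in> dyadic d 0"
      using v by (auto simp: pverts_G)
    then show ?thesis
    proof cases
      case 1
      then have "{u \<in> nbhd G v. f u = 3} = {iv R}"
        using R by (auto simp: nbhd_pt f_def R_def split: if_splits)
      then show ?thesis by (intro exI[of _ 3]) simp
    next
      case 2
      then show ?thesis using g(3)[OF 2(2)] card_nbhd_iv[OF 2(2), of f] by (simp add: f_def)
    qed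
  qed
  ultimately have "proper_odd_coloring G f" unfolding proper_odd_coloring_def by blast
  then have "chi_o G \<le> card (f ` pverts G)" by (rule chi_o_le)
  also have "f ` pverts G \<subseteq> {..<5}"
    using g3 by (fastforce simp: pverts_G f_def intro: less_trans)
  then have "card (f ` pverts G) \<le> 5" by (metis card_lessThan card_mono finite_lessThan)
  finally show ?thesis .
qed

text \<open>The conditions at the interval vertices alone force more than \<open>d\<close> colors on
  the points.\<close>

lemma chi_pcf_dyadic: "d < chi_pcf (interval_graph (2 ^ d) (dyadic d 0))"
proof -
  interpret interval_family "2 ^ d" "dyadic d 0" by (rule interval_family_dyadic)
  obtain f where f: "proper_cf_coloring G f" and card: "card (f ` pverts G) = chi_pcf G"
    using chi_pcf_attained[OF pair_graph_G] .
  have "\<exists>c. card {p \<in> {l..r}. (f \<circ> pt) p = c} = 1" if J: "(l, r) \<in> dyadic d 0" for l r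
  proof -
    have "iv (l, r) \<in> pverts G" "nbhd G (iv (l, r)) \<noteq> {}"
      using J interval[OF J] by (auto simp: pverts_G nbhd_iv)
    then have "\<exists>c. card {u \<in> nbhd G (iv (l, r)). f u = c} = 1"
      using f unfolding proper_cf_coloring_def by blast
    then show ?thesis unfolding card_nbhd_iv[OF J] comp_apply .
  qed
  then have "d < card ((f \<circ> pt) ` {0..<0 + 2 ^ d})" by (rule dyadic_conflict_free_bound)
  also have "\<dots> \<le> card (f ` pverts G)"
    using finite_J by (intro card_mono) (auto simp: pverts_G)
  finally show ?thesis using card by simp
qed

theorem theorem1p7:
  shows "(\<exists>\<G> :: nat pair_pre_digraph set.
            (\<forall>G\<in>\<G>. pair_graph G \<and> convex_bipartite G \<and> grid_intersection_graph G \<and>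
                    comparability_graph_3dim G) \<and>
            (SUP G\<in>\<G>. enat (chi_o G)) = \<infinity>) \<and>
         (\<exists>\<H> :: nat pair_pre_digraph set.
            (\<forall>H\<in>\<H>. pair_graph H \<and> bipartite H \<and> circle_graph H) \<and>
            (SUP H\<in>\<H>. enat (chi_o H)) < \<infinity> \<and>
            (SUP H\<in>\<H>. enat (chi_pcf H)) = \<infinity>)"
proof (intro conjI exI)
  let ?I = "\<lambda>n. {(l, r). l \<le> r \<and> r < n} :: (nat \<times> nat) set"
  let ?\<G> = "range (\<lambda>n. interval_graph n (?I n))"
  have I: "interval_family n (?I n)" for n by unfold_locales auto
  show "\<forall>G\<in>?\<G>. pair_graph G \<and> convex_bipartite G \<and> grid_intersection_graph G \<and>
      comparability_graph_3dim G"
    using interval_family.pair_graph_G[OF I] interval_family.convex_bipartite_G[OF I]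
      interval_family.grid_intersection_graph_G[OF I]
      interval_family.comparability_graph_3dim_G[OF I] by blast
  show "(SUP G\<in>?\<G>. enat (chi_o G)) = \<infinity>"
  proof (rule SUP_enat_eq_infinity)
    fix k
    \<comment> \<open>With \<open>2 ^ k\<close> points the coloring bound reads
      \<open>2 ^ k < 2 ^ chi_o ?G\<close>.\<close>
    let ?G = "interval_graph (2 ^ k) (?I (2 ^ k))"
    obtain f where f: "proper_odd_coloring ?G f" and card: "card (f ` pverts ?G) = chi_o ?G"
      using chi_o_attained[OF interval_family.pair_graph_G[OF I]] .
    then have "(2::nat) ^ k < 2 ^ chi_o ?G" 
      using all_intervals_odd_coloring_bound[OF f] by simp
    then have "k \<le> chi_o ?G" by simp
    then show "\<exists>G\<in>?\<G>. k \<le> chi_o G" by blast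
  qed
  let ?\<H> = "range (\<lambda>d. interval_graph (2 ^ d) (dyadic d 0))"
  show "\<forall>H\<in>?\<H>. pair_graph H \<and> bipartite H \<and> circle_graph H"
    using interval_family.pair_graph_G[OF interval_family_dyadic]
      interval_family.bipartite_G[OF interval_family_dyadic]
      interval_family.circle_graph_G[OF interval_family_dyadic dyadic_laminar] by auto
  have "(SUP H\<in>?\<H>. enat (chi_o H)) \<le> enat 5"
    by (rule SUP_least) (use chi_o_dyadic in auto)
  then show "(SUP H\<in>?\<H>. enat (chi_o H)) < \<infinity>"
    by (rule le_less_trans) simp
  show "(SUP H\<in>?\<H>. enat (chi_pcf H)) = \<infinity>"
    by (rule SUP_enat_eq_infinity) (use chi_pcf_dyadic less_imp_le in blast)
qed

end
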